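(* If $P, Q \in \mathcal{H}_n$ are such that $P \preccurlyeq Q$, then $n^{-1}P' \preccurlyeq n^{-1}Q'$ (as elements of $\mathcal{H}_{n-1}$).
   Context: $\mathcal{H}_n$ denotes the set of monic hyperbolic polynomials of degree $n$, i.e. monic polynomials of degree $n$ all of whose zeros are real. For a polynomial $P$ of degree $n$, $Z(P)$ is the unordered $n$-tuple of its zeros, each repeated according to multiplicity. For two unordered $n$-tuples $X=(x_1,\dots,x_n)$ and $Y=(y_1,\dots,y_n)$ of real numbers, $X \prec Y$ ($X$ is majorized by $Y$, or less than $Y$ in the spectral order) means that $\sum_{i=1}^n f(x_i) \le \sum_{i=1}^n f(y_i)$ for every convex function $f:\mathbb{R}\to\mathbb{R}$; equivalently, there is a doubly stochastic $n\times n$ matrix $A$ with $(x_1,\dots,x_n)^t = A (y_1,\dots,y_n)^t$. For $P,Q$ in the same $\mathcal{H}_m$, $P \preccurlyeq Q$ means $Z(P) \prec Z(Q)$. *)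

theory Defs
  imports
    "HOL-Analysis.Analysis"
    "HOL-Computational_Algebra.Computational_Algebra"
begin

text \<open>
  A monic polynomial with only real zeros has real coefficients, so nothing is lost by working
  with real polynomials.  The zeros are nevertheless taken over the complex numbers: quantifying
  over the real zeros only would make the condition vacuous.
\<close>

definition hyperbolic_polys :: "nat \<Rightarrow> real poly set" where
  "hyperbolic_polys n =
     {P. degree P = n \<and> lead_coeff P = 1 \<and>
         (\<forall>z::complex. poly (map_poly complex_of_real P) z = 0 \<longrightarrow> z \<in> \<real>)}"

text \<open>Unordered \<open>n\<close>-tuples of reals are multisets of size \<open>n\<close>.\<close>

definition majorized :: "real multiset \<Rightarrow> real multiset \<Rightarrow> bool"  (infix \<open>\<prec>\<close> 50) where
  "X \<prec> Y \<longleftrightarrow> size X = size Y \<and>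
     (\<forall>f :: real \<Rightarrow> real. convex_on UNIV f \<longrightarrow> (\<Sum>x\<in>#X. f x) \<le> (\<Sum>y\<in>#Y. f y))"

definition spectral_le :: "real poly \<Rightarrow> real poly \<Rightarrow> bool"  (infix \<open>\<preceq>\<close> 50) where
  "P \<preceq> Q \<longleftrightarrow> proots P \<prec> proots Q"

text \<open>
  For hyperbolic polynomials the real multiset \<^const>\<open>proots\<close> is the complete list of zeros.
\<close>

lemma size_proots_hyperbolic:
  assumes "P \<in> hyperbolic_polys n"
  shows "size (proots P) = n"
  using assms
proof (induction n arbitrary: P)
  case 0
  then show ?case
    using size_proots_le[of P] by (simp add: hyperbolic_polys_def)
next
  case (Suc n)
  let ?c = "map_poly complex_of_real"
  have P: "degree P = Suc n" "lead_coeff P = 1"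
    and real: "\<And>z. poly (?c P) z = 0 \<Longrightarrow> z \<in> \<real>"
    using Suc.prems by (auto simp: hyperbolic_polys_def)
  have "degree (?c P) = Suc n"
    using P by (simp add: degree_map_poly)
  then obtain z where z: "poly (?c P) z = 0"
    using alg_closed_imp_poly_has_root[of "?c P"] by auto
  with real obtain x where "z = complex_of_real x"
    by (auto elim: Reals_cases)
  with z have "poly P x = 0"
    by (simp add: poly_altdef degree_map_poly coeff_map_poly flip: of_real_power of_real_mult of_real_sum)
  then obtain q where q: "P = [:-x, 1:] * q"
    by (auto simp: poly_eq_0_iff_dvd elim: dvdE)
  with P have "q \<noteq> 0" by auto
  have "degree P = Suc (degree q)"
    unfolding q using \<open>q \<noteq> 0\<close> by (subst degree_mult_eq) auto
  moreover have "lead_coeff P = lead_coeff q"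
    unfolding q by (subst lead_coeff_mult) simp
  moreover have "?c P = ?c [:-x, 1:] * ?c q"
    unfolding q by (rule poly_eqI) (simp add: coeff_map_poly coeff_mult del: mult_pCons_left)
  then have "\<forall>w. poly (?c q) w = 0 \<longrightarrow> w \<in> \<real>"
    using real by simp
  ultimately have "q \<in> hyperbolic_polys n"
    using P by (simp add: hyperbolic_polys_def)
  then have "size (proots q) = n"
    by (rule Suc.IH)
  moreover have "proots P = {#x#} + proots q"
    unfolding q using \<open>q \<noteq> 0\<close> by (subst proots_mult) auto
  ultimately show ?case
    by simp
qed

end

theory Submission
  imports Defs "Jordan_Normal_Form.Char_Poly"
begin

text \<open>
  The zeros of \<open>P'\<close> are the eigenvalues of a matrix that depends linearly on the zeros of \<open>P\<close>.
  Let \<open>x\<close> be a list of the \<open>n\<close> zeros of \<open>P\<close>, and let \<open>C x\<close> be the compression of the diagonal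
  matrix of \<open>x\<close> to the orthogonal complement of \<open>e = (1, ..., 1) / sqrt n\<close>.  By Cramer's rule the
  quotient of the characteristic polynomial of \<open>C x\<close> by \<open>P\<close> is the \<open>(e, e)\<close> entry of the
  resolvent, which is \<open>(1 / n) (\<Sum>j. 1 / (t - x j)) = P' / (n P)\<close>; so \<open>C x\<close> has characteristic
  polynomial \<open>P' / n\<close> (\<open>derivative_is_compression\<close>).  As \<open>C x\<close> is symmetric, the spectral theorem
  (\<open>symmetric_mat_diagonalization\<close>) shows that \<open>P'\<close> is hyperbolic.  The result is the same for
  every ordering of the zeros.

  It remains to compare the eigenvalues of \<open>C x\<close> with those of \<open>C y\<close> when the tuple \<open>x\<close> is
  majorized by the zeros \<open>y\<close> of \<open>Q\<close>.  In an orthonormal eigenbasis \<open>u\<close> of \<open>C x\<close>, the eigenvalues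
  \<open>d i\<close> are the diagonal entries of \<open>C x\<close>, hence linear functions of \<open>x\<close>.  For convex \<open>f\<close> with
  subgradients \<open>g\<close>, the tangent bound
  \<open>f (w i) \<ge> f (d i) + g (d i) * (w i - d i)\<close>, summed over the diagonal entries \<open>w i\<close> of \<open>C y\<close> in the
  same basis, has a linear correction term \<open>\<Sum>j. c j * (y j - x j)\<close>.  Majorization lets us order \<open>y\<close>
  so that this term is nonnegative (\<open>majorized_imp_weighted_sum_le\<close>: order \<open>y\<close> like \<open>c\<close>).  Hence
  \<open>\<Sum>i. f (d i) \<le> \<Sum>i. f (w i)\<close>.  Finally the diagonal of \<open>C y\<close> in any orthonormal basis is a
  doubly stochastic image of its spectrum, so Jensen's inequality bounds \<open>\<Sum>i. f (w i)\<close> by the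
  sum of \<open>f\<close> over the zeros of \<open>Q'\<close> (\<open>convex_sum_orthogonal_squares_le\<close>).
\<close>

hide_const (open) Module.smult Determinants.det
no_notation Finite_Cartesian_Product.vec_nth (infixl \<open>$\<close> 90)
no_notation fps_nth (infixl \<open>$\<close> 75)

section \<open>The real spectral theorem\<close>

definition orthogonal_mat :: "nat \<Rightarrow> real mat \<Rightarrow> bool" where
  "orthogonal_mat n U \<longleftrightarrow> U \<in> carrier_mat n n \<and> U * U\<^sup>T = 1\<^sub>m n \<and> U\<^sup>T * U = 1\<^sub>m n"

lemma orthogonal_matI:
  assumes "U \<in> carrier_mat n n" "U\<^sup>T * U = 1\<^sub>m n"
  shows "orthogonal_mat n U"
proof -
  have "U * U\<^sup>T = 1\<^sub>m n"
    by (rule mat_mult_left_right_inverse[of "U\<^sup>T" n U]) (use assms in auto)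
  then show ?thesis using assms by (simp add: orthogonal_mat_def)
qed

lemma orthogonal_mat_mult:
  assumes "orthogonal_mat n U" "orthogonal_mat n V"
  shows "orthogonal_mat n (U * V)"
proof (rule orthogonal_matI)
  have U: "U \<in> carrier_mat n n" "U\<^sup>T * U = 1\<^sub>m n" and V: "V \<in> carrier_mat n n" "V\<^sup>T * V = 1\<^sub>m n"
    using assms by (auto simp: orthogonal_mat_def)
  show "U * V \<in> carrier_mat n n" using U V by auto
  have "U\<^sup>T * (U * V) = V"
    using U V by (simp add: assoc_mult_mat[of "U\<^sup>T" n n U n V n, symmetric])
  then have "(U * V)\<^sup>T * (U * V) = V\<^sup>T * V"
    using U V by (simp add: transpose_mult[of U n n V n] assoc_mult_mat[of _ n n _ n _ n])
  also have "\<dots> = 1\<^sub>m n" using V by simp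
  finally show "(U * V)\<^sup>T * (U * V) = 1\<^sub>m n" .
qed

lemma conjugate_mult:
  fixes A B D :: "real mat"
  assumes A: "A \<in> carrier_mat k n" and B: "B \<in> carrier_mat m k" and D: "D \<in> carrier_mat n n"
  shows "(B * A) * D * (B * A)\<^sup>T = B * (A * D * A\<^sup>T) * B\<^sup>T"
proof -
  have AD: "A * D \<in> carrier_mat k n" using A D by (rule mult_carrier_mat)
  have AT: "A\<^sup>T \<in> carrier_mat n k" and BT: "B\<^sup>T \<in> carrier_mat k m" using A B by auto
  have "(B * A) * D * (B * A)\<^sup>T = B * (A * D) * (A\<^sup>T * B\<^sup>T)"
    by (simp only: transpose_mult[OF B A] assoc_mult_mat[OF B A D])
  also have "\<dots> = B * (A * D * (A\<^sup>T * B\<^sup>T))"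
    by (rule assoc_mult_mat[OF B AD mult_carrier_mat[OF AT BT]])
  also have "A * D * (A\<^sup>T * B\<^sup>T) = A * D * A\<^sup>T * B\<^sup>T"
    by (rule assoc_mult_mat[OF AD AT BT, symmetric])
  also have "B * (A * D * A\<^sup>T * B\<^sup>T) = B * (A * D * A\<^sup>T) * B\<^sup>T"
    by (rule assoc_mult_mat[OF B mult_carrier_mat[OF AD AT] BT, symmetric])
  finally show ?thesis .
qed

text \<open>
  Both the deflation step of the spectral theorem and the choice of a basis containing
  \<open>(1, ..., 1) / sqrt n\<close> need an orthogonal matrix with a prescribed unit first column.  The
  reflection that swaps this column with the first basis vector is such a matrix and is also
  symmetric.
\<close>
lemma householder_reflection:
  fixes v :: "nat \<Rightarrow> real"
  assumes unit: "(\<Sum>i<Suc m. v i ^ 2) = 1"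
  obtains H where "orthogonal_mat (Suc m) H" "H\<^sup>T = H" "\<And>i. i < Suc m \<Longrightarrow> H $$ (i, 0) = v i"
proof -
  define w where "w i = v i - (if i = 0 then 1 else 0)" for i
  \<comment> \<open>\<open>s\<close> is half of the squared norm of \<open>w\<close>.  If it vanishes, then \<open>v\<close> is already the first basis
    vector, and \<open>x / 0 = 0\<close> makes \<open>H\<close> the identity.\<close>
  define s where "s = 1 - v 0"
  define H where "H = Matrix.mat (Suc m) (Suc m)
    (\<lambda>(i, j). (if i = j then 1 else 0) - w i * w j / s)"
  have w2: "(\<Sum>k<Suc m. w k * w k) = 2 * s"
  proof -
    have "(\<Sum>k<Suc m. w k * w k) = (\<Sum>k<Suc m. v k ^ 2 - (if k = 0 then 2 * v 0 - 1 else 0))"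
      by (intro sum.cong) (auto simp: w_def power2_eq_square algebra_simps)
    also have "\<dots> = 2 * s"
      using unit by (simp add: sum_subtractf s_def)
    finally show ?thesis .
  qed
  have w0: "w i = 0" if "s = 0" "i < Suc m" for i
  proof -
    have "(\<Sum>k<Suc m. w k * w k) = 0" using w2 that by simp
    then have "\<forall>k\<in>{..<Suc m}. w k * w k = 0"
      by (subst (asm) sum_nonneg_eq_0_iff) auto
    then show ?thesis using that by auto
  qed
  have carr: "H \<in> carrier_mat (Suc m) (Suc m)" by (simp add: H_def)
  have sym: "H\<^sup>T = H" by (rule eq_matI) (auto simp: H_def)
  have "H * H = 1\<^sub>m (Suc m)"
  proof (rule eq_matI)
    fix i j assume "i < dim_row (1\<^sub>m (Suc m))" "j < dim_col (1\<^sub>m (Suc m))"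
    then have ij: "i < Suc m" "j < Suc m" by auto
    have "(H * H) $$ (i, j) = (\<Sum>k<Suc m. ((if i = k then 1 else 0) - w i * w k / s)
        * ((if k = j then 1 else 0) - w k * w j / s))"
      using ij by (simp add: H_def scalar_prod_def atLeast0LessThan del: sum.lessThan_Suc)
    also have "\<dots> = (\<Sum>k<Suc m. (if k = i then (if i = j then 1 else 0) else 0)
       - (if k = i then w i * w j / s else 0) - (if k = j then w i * w j / s else 0)
       + (w i * w j / s^2) * (w k * w k))"
      by (intro sum.cong) (auto simp: algebra_simps power2_eq_square)
    also have "\<dots> = (if i = j then 1 else 0) - 2 * (w i * w j / s) + (w i * w j / s^2) * (2 * s)"
      unfolding sum.distrib sum_subtractf sum_distrib_left[symmetric] w2 using ij by simp
    also have "\<dots> = (if i = j then 1 else 0)"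
      by (simp add: power2_eq_square)
    finally show "(H * H) $$ (i, j) = 1\<^sub>m (Suc m) $$ (i, j)" using ij by simp
  qed (use carr in auto)
  then have orth: "orthogonal_mat (Suc m) H" using carr sym by (simp add: orthogonal_mat_def)
  have "H $$ (i, 0) = v i" if "i < Suc m" for i
  proof (cases "s = 0")
    case True
    then show ?thesis using w0[OF True that] that by (auto simp: H_def w_def)
  next
    case False
    have "w 0 = - s" by (simp add: w_def s_def)
    then show ?thesis using that False by (auto simp: H_def w_def)
  qed
  then show ?thesis using that orth sym by blast
qed

text \<open>
  For an eigenvector \<open>v\<close>, the Hermitian form \<open>q\<close> of \<open>A\<close> at \<open>v\<close> equals its own conjugate by symmetry of
  \<open>A\<close>, and it is \<open>z\<close> times the squared norm of \<open>v\<close>.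
\<close>
lemma symmetric_mat_complex_eigenvalue_real:
  assumes A: "A \<in> carrier_mat n n" "A\<^sup>T = A"
    and ev: "eigenvalue (map_mat complex_of_real A) z"
  shows "z \<in> \<real>"
proof -
  let ?A = "map_mat complex_of_real A"
  obtain v where v: "v \<in> carrier_vec n" "v \<noteq> 0\<^sub>v n" "?A *\<^sub>v v = z \<cdot>\<^sub>v v"
    using ev A by (auto simp: eigenvalue_def eigenvector_def)
  define q where "q = (\<Sum>i<n. \<Sum>j<n. cnj (v $ i) * of_real (A $$ (i, j)) * v $ j)"
  define s where "s = (\<Sum>i<n. (cmod (v $ i))^2)"
  have row: "(\<Sum>j<n. of_real (A $$ (i, j)) * v $ j) = z * v $ i" if "i < n" for i
  proof -
    have "(\<Sum>j<n. of_real (A $$ (i, j)) * v $ j) = (?A *\<^sub>v v) $ i"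
      using that A(1) v(1) by (simp add: scalar_prod_def atLeast0LessThan)
    also have "\<dots> = z * v $ i" using that v(1) by (simp add: v(3))
    finally show ?thesis .
  qed
  have "q = (\<Sum>i<n. cnj (v $ i) * (z * v $ i))"
    unfolding q_def by (intro sum.cong) (simp_all add: row[symmetric] sum_distrib_left mult.assoc)
  also have "\<dots> = z * of_real s"
    unfolding s_def of_real_sum sum_distrib_left
    by (intro sum.cong) (simp_all add: complex_norm_square mult_ac del: of_real_power)
  finally have qz: "q = z * of_real s" .
  have "cnj q = (\<Sum>i<n. \<Sum>j<n. v $ i * of_real (A $$ (i, j)) * cnj (v $ j))"
    by (simp add: q_def)
  also have "\<dots> = (\<Sum>j<n. \<Sum>i<n. v $ i * of_real (A $$ (i, j)) * cnj (v $ j))"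
    by (rule sum.swap)
  also have "\<dots> = q"
    unfolding q_def
  proof (intro sum.cong refl)
    fix i j assume "i \<in> {..<n}" "j \<in> {..<n}"
    then have "A $$ (j, i) = A\<^sup>T $$ (i, j)" using A(1) by simp
    then show "v $ j * of_real (A $$ (j, i)) * cnj (v $ i) = cnj (v $ i) * of_real (A $$ (i, j)) * v $ j"
      using A(2) by simp
  qed
  finally have "q \<in> \<real>" by (simp add: complex_is_Real_iff complex_eq_iff)
  have "s \<noteq> 0"
  proof
    assume "s = 0"
    then have "\<forall>i\<in>{..<n}. (cmod (v $ i))^2 = 0"
      unfolding s_def by (subst (asm) sum_nonneg_eq_0_iff) auto
    then have "v = 0\<^sub>v n" using v by (intro eq_vecI) auto
    then show False using v by simp
  qed
  then have "z = q / of_real s" using qz by simp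
  then show ?thesis using \<open>q \<in> \<real>\<close> by auto
qed

lemma symmetric_mat_unit_eigenvector:
  assumes A: "A \<in> carrier_mat n n" "A\<^sup>T = A" and "n > 0"
  obtains r :: real and v :: "real vec" where "v \<in> carrier_vec n" "(\<Sum>i<n. (v $ i)^2) = 1" "A *\<^sub>v v = r \<cdot>\<^sub>v v"
proof -
  let ?A = "map_mat complex_of_real A"
  have cA: "?A \<in> carrier_mat n n" using A by simp
  have "degree (char_poly ?A) = n" using degree_monic_char_poly[OF cA] by simp
  then obtain z where z: "poly (char_poly ?A) z = 0"
    using alg_closed_imp_poly_has_root[of "char_poly ?A"] \<open>n > 0\<close> by auto
  then have "eigenvalue ?A z" using eigenvalue_root_char_poly[OF cA] by simp
  then have "z \<in> \<real>" using symmetric_mat_complex_eigenvalue_real[OF A] by simp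
  then obtain r where r: "z = complex_of_real r" by (auto elim: Reals_cases)
  have "char_poly ?A = map_poly complex_of_real (char_poly A)"
    by (rule of_real_hom.char_poly_hom[OF A(1)])
  then have "poly (char_poly A) r = 0" using z r
    by simp
  then have "eigenvalue A r" using eigenvalue_root_char_poly[OF A(1)] by simp
  then obtain x where x: "x \<in> carrier_vec n" "x \<noteq> 0\<^sub>v n" "A *\<^sub>v x = r \<cdot>\<^sub>v x"
    using A by (auto simp: eigenvalue_def eigenvector_def)
  define s where "s = (\<Sum>i<n. (x $ i)^2)"
  have "s \<noteq> 0"
  proof
    assume "s = 0"
    then have "\<forall>i\<in>{..<n}. (x $ i)^2 = 0"
      unfolding s_def by (subst (asm) sum_nonneg_eq_0_iff) auto
    then have "x = 0\<^sub>v n" using x by (intro eq_vecI) auto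
    then show False using x by simp
  qed
  moreover have "s \<ge> 0" unfolding s_def by (intro sum_nonneg) auto
  ultimately have s: "s > 0" by simp
  define v where "v = (1 / sqrt s) \<cdot>\<^sub>v x"
  have "v \<in> carrier_vec n" using x by (simp add: v_def)
  moreover have "(\<Sum>i<n. (v $ i)^2) = 1"
  proof -
    have "(\<Sum>i<n. (v $ i)^2) = (\<Sum>i<n. (x $ i)^2 / s)"
      using x s by (intro sum.cong) (auto simp: v_def power_divide)
    also have "\<dots> = 1" using s by (simp add: s_def flip: sum_divide_distrib)
    finally show ?thesis .
  qed
  moreover have "A *\<^sub>v v = r \<cdot>\<^sub>v v"
    using x A by (simp add: v_def mult_mat_vec[of _ n n] smult_smult_assoc mult.commute)
  ultimately show ?thesis using that by blast
qed

text \<open>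
  Deflation: reflect a unit eigenvector to the first basis vector.  The first column of the
  conjugated matrix then vanishes off the diagonal, by symmetry so does the first row, and the
  remaining block is a smaller symmetric matrix.
\<close>
lemma symmetric_mat_diagonalization:
  assumes "A \<in> carrier_mat n n" "A\<^sup>T = A"
  obtains U d where "orthogonal_mat n U" "A = U * mat_diag n d * U\<^sup>T"
  using assms
proof (induction n arbitrary: A thesis)
  case 0
  show ?case
    by (rule 0(1)[of "1\<^sub>m 0"]) (use 0 in \<open>auto simp: orthogonal_mat_def intro!: eq_matI\<close>)
next
  case (Suc m)
  let ?n = "Suc m"
  have A: "A \<in> carrier_mat ?n ?n" "A\<^sup>T = A" using Suc.prems by auto
  obtain r v where v: "v \<in> carrier_vec ?n" "(\<Sum>i<?n. (v $ i)^2) = 1" "A *\<^sub>v v = r \<cdot>\<^sub>v v"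
    by (rule symmetric_mat_unit_eigenvector[OF A]) simp_all
  obtain H where H: "orthogonal_mat ?n H" "H\<^sup>T = H" "\<And>i. i < ?n \<Longrightarrow> H $$ (i, 0) = v $ i"
    using householder_reflection[OF v(2)] by metis
  have Hc: "H \<in> carrier_mat ?n ?n" and HH: "H * H = 1\<^sub>m ?n"
    using H by (auto simp: orthogonal_mat_def)
  have colH: "col H 0 = v" using Hc v H(3) by (intro eq_vecI) auto
  define B where "B = H * A * H"
  have Bc: "B \<in> carrier_mat ?n ?n" using A Hc by (simp add: B_def)
  have symB: "B\<^sup>T = B"
    using A Hc H(2) by (simp add: B_def transpose_mult[of _ ?n ?n _ ?n] assoc_mult_mat[of _ ?n ?n _ ?n _ ?n])
  have "col (H * H) 0 = H *\<^sub>v v" using Hc by (simp add: col_mult2[of _ ?n ?n _ ?n] colH del: col_mult)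
  then have Hv: "H *\<^sub>v v = unit_vec ?n 0" by (simp add: HH)
  have "col B 0 = (H * A) *\<^sub>v v"
    unfolding B_def using Hc A colH by (subst col_mult2[of _ ?n ?n _ ?n]) auto
  also have "\<dots> = H *\<^sub>v (r \<cdot>\<^sub>v v)" using Hc A v by (simp add: assoc_mult_mat_vec[of _ ?n ?n _ ?n])
  also have "\<dots> = r \<cdot>\<^sub>v unit_vec ?n 0" using Hc v Hv by (simp add: mult_mat_vec[of _ ?n ?n])
  finally have colB: "col B 0 = r \<cdot>\<^sub>v unit_vec ?n 0" .
  have B_i0: "B $$ (i, 0) = (if i = 0 then r else 0)" if "i < ?n" for i
  proof -
    have "B $$ (i, 0) = col B 0 $ i" using Bc that by simp
    then show ?thesis using that by (simp add: colB)
  qed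
  have B_sym: "B $$ (i, j) = B $$ (j, i)" if "i < ?n" "j < ?n" for i j
    using arg_cong[OF symB, of "\<lambda>M. M $$ (i, j)"] Bc that by simp
  have B_0j: "B $$ (0, j) = (if j = 0 then r else 0)" if "j < ?n" for j
    using B_sym[of 0 j] B_i0[of j] that by simp
  define C where "C = Matrix.mat m m (\<lambda>(i, j). B $$ (Suc i, Suc j))"
  have Cc: "C \<in> carrier_mat m m" and symC: "C\<^sup>T = C"
    using B_sym by (auto simp: C_def intro!: eq_matI)
  obtain U d where U: "orthogonal_mat m U" and C: "C = U * mat_diag m d * U\<^sup>T"
    using Suc.IH[OF _ Cc symC] by blast
  have Uc: "U \<in> carrier_mat m m" using U by (simp add: orthogonal_mat_def)
  define V where "V = four_block_mat (1\<^sub>m 1) (0\<^sub>m 1 m) (0\<^sub>m m 1) U"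
  define d' where "d' = case_nat r d"
  have Vc: "V \<in> carrier_mat ?n ?n" unfolding V_def using Uc by auto
  have VT: "V\<^sup>T = four_block_mat (1\<^sub>m 1) (0\<^sub>m 1 m) (0\<^sub>m m 1) (U\<^sup>T)"
    unfolding V_def using Uc by (subst transpose_four_block_mat[of _ 1 1 _ m _ m]) auto
  have D: "mat_diag ?n d' = four_block_mat (mat_diag 1 (\<lambda>_. r)) (0\<^sub>m 1 m) (0\<^sub>m m 1) (mat_diag m d)"
    by (rule eq_matI) (auto simp: mat_diag_def d'_def split: nat.splits)
  have V: "orthogonal_mat ?n V"
  proof (rule orthogonal_matI[OF Vc])
    have "V\<^sup>T * V = four_block_mat (1\<^sub>m 1) (0\<^sub>m 1 m) (0\<^sub>m m 1) (1\<^sub>m m)"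
      unfolding VT unfolding V_def using U Uc
      by (subst mult_four_block_mat[of _ 1 1 _ m _ m _ _ 1 _ m]) (auto simp: orthogonal_mat_def)
    then show "V\<^sup>T * V = 1\<^sub>m ?n" by simp
  qed
  have "V * mat_diag ?n d' * V\<^sup>T = four_block_mat (mat_diag 1 (\<lambda>_. r)) (0\<^sub>m 1 m) (0\<^sub>m m 1) C"
  proof -
    have "V * mat_diag ?n d' = four_block_mat (mat_diag 1 (\<lambda>_. r)) (0\<^sub>m 1 m) (0\<^sub>m m 1) (U * mat_diag m d)"
      unfolding D V_def using Uc
      by (subst mult_four_block_mat[of _ 1 1 _ m _ m _ _ 1 _ m])
        (auto simp: left_mult_one_mat[OF mat_diag_dim] left_mult_zero_mat[OF mat_diag_dim]
          right_add_zero_mat[OF mat_diag_dim] left_add_zero_mat[OF zero_carrier_mat])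
    moreover have UDc: "U * mat_diag m d \<in> carrier_mat m m"
      using Uc by (intro mult_carrier_mat[of _ m m]) auto
    moreover have "U * mat_diag m d * U\<^sup>T \<in> carrier_mat m m"
      using Uc by (intro mult_carrier_mat[OF UDc]) auto
    ultimately show ?thesis
      unfolding VT C using Uc
      by (simp only:, subst mult_four_block_mat[of _ 1 1 _ m _ m _ _ 1 _ m])
        (auto simp: right_mult_one_mat[OF mat_diag_dim] right_mult_zero_mat[OF mat_diag_dim]
          right_mult_zero_mat[OF UDc] right_add_zero_mat[OF mat_diag_dim]
          left_add_zero_mat[of _ m m] left_add_zero_mat[OF zero_carrier_mat])
  qed
  also have "\<dots> = B"
    using B_i0 B_0j Bc
    by (intro eq_matI) (auto simp: C_def mat_diag_def less_Suc_eq_0_disj)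
  finally have B: "B = V * mat_diag ?n d' * V\<^sup>T" ..
  have "A = H * B * H"
  proof -
    have "(H * H) * (A * (H * H)) = H * B * H"
      unfolding B_def using A Hc by (simp add: assoc_mult_mat[of _ ?n ?n _ ?n _ ?n])
    then show ?thesis using A by (simp add: HH)
  qed
  also have "\<dots> = (H * V) * mat_diag ?n d' * (H * V)\<^sup>T"
    by (simp only: B conjugate_mult[OF Vc Hc mat_diag_dim] H(2))
  finally show ?case
    using Suc.prems(1) orthogonal_mat_mult[OF H(1) V] by blast
qed

lemma char_poly_orthogonal_diagonal:
  assumes U: "orthogonal_mat n U" and A: "A = U * mat_diag n d * U\<^sup>T"
  shows "char_poly A = (\<Prod>k<n. [:- d k, 1:])"
proof -
  have Uc: "U \<in> carrier_mat n n" using U by (simp add: orthogonal_mat_def)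
  have "similar_mat_wit A (mat_diag n d) U (U\<^sup>T)"
    using U Uc by (intro similar_mat_witI[of _ _ n]) (auto simp: A orthogonal_mat_def)
  then have "char_poly A = char_poly (mat_diag n d)"
    by (intro char_poly_similar) (auto simp: similar_mat_def)
  also have "\<dots> = (\<Prod>a\<leftarrow>diag_mat (mat_diag n d). [:- a, 1:])"
    by (rule char_poly_upper_triangular[of _ n]) (auto simp: mat_diag_def)
  also have "diag_mat (mat_diag n d) = map d [0..<n]"
    by (auto simp: diag_mat_def mat_diag_def)
  also have "(\<Prod>a\<leftarrow>map d [0..<n]. [:- a, 1:]) = (\<Prod>k<n. [:- d k, 1:])"
    by (simp add: prod.distinct_set_conv_list[symmetric] atLeast0LessThan o_def)
  finally show ?thesis .
qed

section \<open>The derivative as a compression of a diagonal matrix\<close>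

text \<open>
  Deleting the first row and column of \<open>H diag(x) H\<^sup>T\<close> compresses \<open>diag(x)\<close> to the orthogonal
  complement of the first row of \<open>H\<close>.  At a point \<open>t\<close> off the zeros, the characteristic polynomial of
  the compression is a principal cofactor of \<open>M = H diag(t - x) H\<^sup>T\<close>, that is, \<open>det M\<close> times an entry
  of the inverse of \<open>M\<close>.  All weights in that entry are \<open>1 / n\<close> because the first row of \<open>H\<close> is
  flat, so the product rule turns it into the derivative.  Infinitely many such \<open>t\<close> determine the
  polynomial.
\<close>
lemma char_poly_mat_delete_orthogonal_conjugate:
  fixes x :: "nat \<Rightarrow> real"
  assumes H: "orthogonal_mat (Suc m) H"
    and unbiased: "\<And>j. j < Suc m \<Longrightarrow> (H $$ (0, j))^2 = 1 / real (Suc m)"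
  shows "char_poly (mat_delete (H * mat_diag (Suc m) x * H\<^sup>T) 0 0)
    = smult (1 / real (Suc m)) (pderiv (\<Prod>j<Suc m. [:- x j, 1:]))"
proof -
  let ?n = "Suc m"
  let ?S = "\<lambda>d. H * mat_diag ?n d * H\<^sup>T"
  let ?C = "mat_delete (?S x) 0 0"
  let ?p = "smult (1 / real ?n) (pderiv (\<Prod>j<?n. [:- x j, 1:]))"
  have Hc: "H \<in> carrier_mat ?n ?n" and HH: "H * H\<^sup>T = 1\<^sub>m ?n" "H\<^sup>T * H = 1\<^sub>m ?n"
    using H by (auto simp: orthogonal_mat_def)
  have Sc: "?S d \<in> carrier_mat ?n ?n" for d
    using Hc by (intro mult_carrier_mat[of _ ?n ?n]) auto
  have Cc: "?C \<in> carrier_mat m m" using mat_delete_carrier[OF Sc, of x 0 0] by simp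
  have S_index: "?S d $$ (i, k) = (\<Sum>j<?n. H $$ (i, j) * d j * H $$ (k, j))"
    if "i < ?n" "k < ?n" for d i k
    using Hc that by (subst mat_diag_mult_right[OF Hc])
      (simp add: scalar_prod_def atLeast0LessThan del: sum.lessThan_Suc)
  note carr = mult_carrier_mat[of _ ?n ?n _ ?n]
  have S_mult: "?S c * ?S d = ?S (\<lambda>j. c j * d j)" for c d
  proof -
    have "H\<^sup>T * (H * (mat_diag ?n d * H\<^sup>T)) = mat_diag ?n d * H\<^sup>T"
      using Hc by (subst assoc_mult_mat[of _ ?n ?n _ ?n _ ?n, symmetric])
        (auto simp: HH carr left_mult_one_mat[of _ ?n ?n])
    then have "?S c * ?S d = H * (mat_diag ?n c * (mat_diag ?n d * H\<^sup>T))"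
      using Hc by (simp add: assoc_mult_mat[of _ ?n ?n _ ?n _ ?n] carr)
    also have "\<dots> = H * ((mat_diag ?n c * mat_diag ?n d) * H\<^sup>T)"
      using Hc by (subst assoc_mult_mat[of _ ?n ?n _ ?n _ ?n]) (auto simp: carr)
    also have "\<dots> = ?S (\<lambda>j. c j * d j)"
      using Hc by (simp add: assoc_mult_mat[of _ ?n ?n _ ?n _ ?n] carr)
    finally show ?thesis .
  qed
  have S_one: "?S (\<lambda>_. 1) = 1\<^sub>m ?n" using Hc HH by simp
  have det_S: "det (?S d) = (\<Prod>j<?n. d j)" for d
  proof -
    have "similar_mat_wit (?S d) (mat_diag ?n d) H (H\<^sup>T)"
      using H Hc by (intro similar_mat_witI[of _ _ ?n]) (auto simp: orthogonal_mat_def)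
    then have "det (?S d) = det (mat_diag ?n d)"
      by (intro det_similar) (auto simp: similar_mat_def)
    also have "\<dots> = prod_list (diag_mat (mat_diag ?n d))"
      by (rule det_upper_triangular[of _ ?n]) (auto simp: mat_diag_def)
    also have "diag_mat (mat_diag ?n d) = map d [0..<?n]"
      unfolding diag_mat_def mat_diag_def by (intro map_cong) auto
    also have "prod_list (map d [0..<?n]) = (\<Prod>j<?n. d j)"
      by (simp only: prod.distinct_set_conv_list[symmetric] distinct_upt set_upt atLeast0LessThan)
    finally show ?thesis .
  qed
  have eq: "poly (char_poly ?C) t = poly ?p t" if t: "t \<notin> x ` {..<?n}" for t
  proof -
    define M where "M = ?S (\<lambda>j. t - x j)"
    define N where "N = ?S (\<lambda>j. 1 / (t - x j))"
    have Mc: "M \<in> carrier_mat ?n ?n" and Nc: "N \<in> carrier_mat ?n ?n"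
      unfolding M_def N_def by (rule Sc)+
    have "M * N = ?S (\<lambda>j. (t - x j) * (1 / (t - x j)))" by (simp only: M_def N_def S_mult)
    also have "mat_diag ?n (\<lambda>j. (t - x j) * (1 / (t - x j))) = mat_diag ?n (\<lambda>_. 1)"
      using t by (intro eq_matI) (auto simp: mat_diag_def)
    finally have MN: "M * N = 1\<^sub>m ?n" using S_one by simp
    have "adj_mat M = adj_mat M * (M * N)"
      using adj_mat(1)[OF Mc] by (simp add: MN)
    also have "\<dots> = (adj_mat M * M) * N"
      using adj_mat(1)[OF Mc] Mc Nc by (simp add: assoc_mult_mat[of _ ?n ?n _ ?n _ ?n])
    also have "\<dots> = det M \<cdot>\<^sub>m N"
      using Nc by (simp add: adj_mat(3)[OF Mc] mult_smult_assoc_mat[of _ ?n ?n _ ?n])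
    finally have adj: "adj_mat M = det M \<cdot>\<^sub>m N" .
    \<comment> \<open>The sign convention of \<^const>\<open>char_matrix\<close> is \<open>A - t\<close>.\<close>
    have "- char_matrix ?C t = mat_delete M 0 0"
    proof (rule eq_matI)
      fix i k assume "i < dim_row (mat_delete M 0 0)" "k < dim_col (mat_delete M 0 0)"
      then have ik: "i < m" "k < m" using Mc by auto
      have I: "(\<Sum>j<?n. H $$ (Suc i, j) * 1 * H $$ (Suc k, j)) = (if i = k then 1 else 0)"
        using S_index[of "Suc i" "Suc k" "\<lambda>_. 1", symmetric] ik
        unfolding S_one by (simp del: sum.lessThan_Suc)
      have "mat_delete M 0 0 $$ (i, k) = M $$ (Suc i, Suc k)"
        using Mc ik by (simp add: mat_delete_def)
      also have "\<dots> = (\<Sum>j<?n. t * (H $$ (Suc i, j) * 1 * H $$ (Suc k, j))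
          - H $$ (Suc i, j) * x j * H $$ (Suc k, j))"
        unfolding M_def using ik by (subst S_index) (auto intro!: sum.cong simp: algebra_simps simp del: sum.lessThan_Suc)
      also have "\<dots> = t * (if i = k then 1 else 0) - ?S x $$ (Suc i, Suc k)"
        unfolding sum_subtractf sum_distrib_left[symmetric] I using ik by (simp add: S_index del: sum.lessThan_Suc)
      also have "?S x $$ (Suc i, Suc k) = ?C $$ (i, k)"
        using Hc ik by (simp add: mat_delete_def)
      also have "t * (if i = k then 1 else 0) - ?C $$ (i, k) = (- char_matrix ?C t) $$ (i, k)"
        using Cc ik by (auto simp: char_matrix_def)
      finally show "(- char_matrix ?C t) $$ (i, k) = mat_delete M 0 0 $$ (i, k)" ..
    qed (use Cc Mc in \<open>auto simp: char_matrix_def\<close>)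
    then have "poly (char_poly ?C) t = det (mat_delete M 0 0)"
      by (simp add: char_poly_matrix[OF Cc])
    also have "\<dots> = adj_mat M $$ (0, 0)"
      using Mc by (simp add: adj_mat_def cofactor_def)
    also have "\<dots> = det M * N $$ (0, 0)" using Nc by (simp add: adj)
    also have "N $$ (0, 0) = (\<Sum>j<?n. H $$ (0, j) * (1 / (t - x j)) * H $$ (0, j))"
      unfolding N_def by (rule S_index) simp_all
    also have "\<dots> = (\<Sum>j<?n. (1 / real ?n) * (1 / (t - x j)))"
    proof (intro sum.cong refl)
      fix j assume "j \<in> {..<?n}"
      then have "(H $$ (0, j))^2 = 1 / real ?n" by (intro unbiased) simp
      moreover have "H $$ (0, j) * (1 / (t - x j)) * H $$ (0, j) = (H $$ (0, j))^2 * (1 / (t - x j))"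
        by (simp add: power2_eq_square)
      ultimately show "H $$ (0, j) * (1 / (t - x j)) * H $$ (0, j) = (1 / real ?n) * (1 / (t - x j))"
        by (simp only:)
    qed
    also have "det M = (\<Prod>j<?n. t - x j)" by (simp only: M_def det_S)
    also have "(\<Prod>j<?n. t - x j) * (\<Sum>j<?n. (1 / real ?n) * (1 / (t - x j)))
       = (1 / real ?n) * (\<Sum>j<?n. (\<Prod>j<?n. t - x j) * (1 / (t - x j)))"
      unfolding sum_distrib_left by (intro sum.cong) simp_all
    also have "(\<Sum>j<?n. (\<Prod>j<?n. t - x j) * (1 / (t - x j))) = (\<Sum>j<?n. \<Prod>i\<in>{..<?n} - {j}. t - x i)"
    proof (intro sum.cong refl)
      fix j assume j: "j \<in> {..<?n}"
      have "(\<Prod>j<?n. t - x j) = (t - x j) * (\<Prod>i\<in>{..<?n} - {j}. t - x i)"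
        using j by (intro prod.remove) auto
      then show "(\<Prod>j<?n. t - x j) * (1 / (t - x j)) = (\<Prod>i\<in>{..<?n} - {j}. t - x i)"
        using t j by auto
    qed
    also have "(1 / real ?n) * \<dots> = poly ?p t"
      by (simp add: pderiv_prod poly_sum poly_prod pderiv_pCons del: prod.lessThan_Suc sum.lessThan_Suc of_nat_Suc)
    finally show ?thesis .
  qed
  show ?thesis
  proof (rule ccontr)
    assume "char_poly ?C \<noteq> ?p"
    then have "finite {t. poly (char_poly ?C - ?p) t = 0}" by (intro poly_roots_finite) simp
    moreover have "- (x ` {..<?n}) \<subseteq> {t. poly (char_poly ?C - ?p) t = 0}" using eq by auto
    ultimately have "finite (- (x ` {..<?n}))" by (rule rev_finite_subset)
    then show False using infinite_UNIV_char_0[where 'a = real] by (simp add: finite_compl)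
  qed
qed

text \<open>
  One matrix \<open>G\<close>, whose rows are an orthonormal basis of the complement of \<open>(1, ..., 1)\<close>, serves all
  tuples \<open>x\<close>.  This is what makes compressions for different zeros comparable.
\<close>
lemma derivative_is_compression:
  obtains G :: "real mat" where "G \<in> carrier_mat m (Suc m)"
    "\<And>x. char_poly (G * mat_diag (Suc m) x * G\<^sup>T)
      = smult (1 / real (Suc m)) (pderiv (\<Prod>j<Suc m. [:- x j, 1:]))"
proof -
  let ?n = "Suc m"
  have "(\<Sum>i<?n. (1 / sqrt (real ?n))^2) = 1" by (simp add: power_divide)
  then obtain H where H: "orthogonal_mat ?n H" "H\<^sup>T = H"
    "\<And>i. i < ?n \<Longrightarrow> H $$ (i, 0) = 1 / sqrt (real ?n)"
    by (rule householder_reflection) blast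
  have Hc: "H \<in> carrier_mat ?n ?n" using H by (simp add: orthogonal_mat_def)
  have "(H $$ (0, j))^2 = 1 / real ?n" if "j < ?n" for j
  proof -
    have "H $$ (0, j) = H\<^sup>T $$ (j, 0)" using Hc that by simp
    then show ?thesis using H(2,3) that by (simp add: power_divide)
  qed
  note cp = char_poly_mat_delete_orthogonal_conjugate[OF H(1) this]
  define G where "G = Matrix.mat m ?n (\<lambda>(i, j). H $$ (Suc i, j))"
  have Gc: "G \<in> carrier_mat m ?n" by (simp add: G_def)
  have "G * mat_diag ?n x * G\<^sup>T = mat_delete (H * mat_diag ?n x * H\<^sup>T) 0 0" for x
    unfolding mat_diag_mult_right[OF Gc] mat_diag_mult_right[OF Hc]
    using Hc by (intro eq_matI) (auto simp: G_def mat_delete_def scalar_prod_def)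
  then show ?thesis using that[OF Gc] cp by simp
qed

section \<open>Polynomials determined by their zeros\<close>

lemma monic_eq_prod_proots:
  fixes p :: "'a :: idom poly"
  assumes "lead_coeff p = 1" "size (proots p) = degree p"
  shows "p = (\<Prod>a\<in>#proots p. [:- a, 1:])"
  using assms
proof (induction "degree p" arbitrary: p)
  case 0
  then show ?case by (simp add: monic_degree_0)
next
  case (Suc n)
  then obtain a where a: "a \<in># proots p"
    by (metis multiset_nonemptyE nat.distinct(1) size_empty)
  have p: "p \<noteq> 0" using Suc by auto
  then have "poly p a = 0" using a by simp
  then obtain q where q: "p = [:- a, 1:] * q"
    by (auto simp: poly_eq_0_iff_dvd elim: dvdE)
  with p have q0: "q \<noteq> 0" by auto
  have deg: "degree p = Suc (degree q)"
    unfolding q using q0 by (subst degree_mult_eq) auto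
  have roots: "proots p = add_mset a (proots q)"
    unfolding q using q0 by (subst proots_mult) auto
  have lc: "lead_coeff p = lead_coeff q"
    unfolding q by (subst lead_coeff_mult) simp
  have "q = (\<Prod>b\<in>#proots q. [:- b, 1:])"
    using Suc deg roots lc by (intro Suc.hyps(1)) auto
  then show ?case unfolding roots using q by simp
qed

lemma prod_linear_hyperbolic:
  fixes d :: "nat \<Rightarrow> real"
  shows "(\<Prod>k<m. [:- d k, 1:]) \<in> hyperbolic_polys m"
    and "proots (\<Prod>k<m. [:- d k, 1:]) = image_mset d (mset_set {..<m})"
proof -
  have "map_poly complex_of_real (\<Prod>k<m. [:- d k, 1:]) = (\<Prod>k<m. [:- complex_of_real (d k), 1:])"
  proof -
    interpret map_poly_idom_hom complex_of_real ..
    show ?thesis by (simp add: hom_prod)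
  qed
  then have "poly (map_poly complex_of_real (\<Prod>k<m. [:- d k, 1:])) z = (\<Prod>k<m. z - of_real (d k))" for z
    by (simp add: poly_prod)
  moreover have "degree (\<Prod>k<m. [:- d k, 1:]) = m"
    by (subst degree_prod_eq_sum_degree) auto
  moreover have "lead_coeff (\<Prod>k<m. [:- d k, 1:]) = 1"
    by (simp add: lead_coeff_prod)
  ultimately show "(\<Prod>k<m. [:- d k, 1:]) \<in> hyperbolic_polys m"
    by (auto simp: hyperbolic_polys_def)
  show "proots (\<Prod>k<m. [:- d k, 1:]) = image_mset d (mset_set {..<m})"
    by (subst proots_prod) (auto simp: sum_unfold_sum_mset)
qed

lemma hyperbolic_poly_eq_prod:
  assumes "P \<in> hyperbolic_polys n" "image_mset x (mset_set {..<n}) = proots P"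
  shows "P = (\<Prod>j<n. [:- x j, 1:])"
proof -
  have "P = (\<Prod>a\<in>#proots P. [:- a, 1:])"
    using assms size_proots_hyperbolic[OF assms(1)]
    by (intro monic_eq_prod_proots) (auto simp: hyperbolic_polys_def)
  also have "\<dots> = (\<Prod>j<n. [:- x j, 1:])"
    unfolding assms(2)[symmetric] by (simp add: prod_unfold_prod_mset multiset.map_comp o_def)
  finally show ?thesis .
qed

section \<open>Majorization and weighted sums\<close>

lemma mset_eq_image_mset_lessThan:
  assumes "size X = n"
  obtains x where "image_mset x (mset_set {..<n}) = X"
proof -
  obtain xs where xs: "mset xs = X" using ex_mset by blast
  then have "map ((!) xs) [0..<n] = xs" using assms by (auto intro: nth_equalityI)
  then have "image_mset ((!) xs) (mset_set {..<n}) = X"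
    using xs by (metis atLeast0LessThan mset_map mset_upt)
  then show ?thesis using that by blast
qed

lemma antimono_rearrangement:
  fixes c :: "nat \<Rightarrow> real"
  obtains p where "p permutes {..<n}" "antimono_on {..<n} (c \<circ> p)"
proof -
  define ys where "ys = rev (sort (map c [0..<n]))"
  have "mset (map c [0..<n]) = mset ys" by (simp add: ys_def)
  then obtain p where p: "p permutes {..<length (map c [0..<n])}" "permute_list p (map c [0..<n]) = ys"
    using mset_eq_permutation by metis
  then have pn: "p permutes {..<n}" by simp
  have "ys ! i = c (p i)" if "i < n" for i
    using that permute_list_nth[OF p(1), of i] p(2) permutes_in_image[OF pn, of i] by auto
  moreover have "ys ! j \<le> ys ! i" if "i \<le> j" "j < n" for i j
    using that by (auto simp: ys_def intro: sorted_rev_nth_mono)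
  ultimately have "antimono_on {..<n} (c \<circ> p)"
    by (auto simp: monotone_on_def)
  then show ?thesis using that pn by blast
qed

text \<open>
  Summation by parts: the sum is a combination of the nonnegative partial sums of \<open>d\<close> with the
  nonnegative weights \<open>c k - c (Suc k)\<close>, and the boundary term vanishes with the total.
\<close>
lemma abel_summation_nonneg:
  fixes c d :: "nat \<Rightarrow> real"
  assumes c: "antimono_on {..<n} c"
    and partial: "\<And>k. k < n \<Longrightarrow> 0 \<le> (\<Sum>j<k. d j)" and total: "(\<Sum>j<n. d j) = 0"
  shows "0 \<le> (\<Sum>j<n. c j * d j)"
proof (cases n)
  case (Suc m)
  have "c k * (\<Sum>j<Suc k. d j) \<le> (\<Sum>j<Suc k. c j * d j)" if "k < n" for k
    using that
  proof (induction k)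
    case (Suc k)
    have "c (Suc k) * (\<Sum>j<Suc k. d j) \<le> c k * (\<Sum>j<Suc k. d j)"
      using Suc.prems partial[of "Suc k"] c
      by (intro mult_right_mono) (auto simp: monotone_on_def)
    then show ?case using Suc by (simp add: algebra_simps)
  qed simp
  from this[of m] show ?thesis using Suc total by simp
qed simp

lemma convex_on_hinge: "convex_on UNIV (\<lambda>t::real. max 0 (t - c))"
proof (rule convex_onI)
  fix t x y :: real assume t: "0 < t" "t < 1"
  have "(1 - t) *\<^sub>R x + t *\<^sub>R y - c = (1 - t) * (x - c) + t * (y - c)"
    by (simp add: algebra_simps)
  also have "\<dots> \<le> (1 - t) * max 0 (x - c) + t * max 0 (y - c)"
    using t by (intro add_mono mult_left_mono) auto
  finally show "max 0 ((1 - t) *\<^sub>R x + t *\<^sub>R y - c) \<le> (1 - t) * max 0 (x - c) + t * max 0 (y - c)"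
    using t by simp
qed simp

text \<open>
  The hinge function with its kink at the last counted entry of \<open>y\<close> is exact on the first \<open>k\<close>
  entries of \<open>y\<close> and zero on the others, while it only overestimates the entries of \<open>x\<close>.
\<close>
lemma majorized_partial_sums:
  fixes x y :: "nat \<Rightarrow> real"
  assumes maj: "image_mset x (mset_set {..<n}) \<prec> image_mset y (mset_set {..<n})"
    and y: "antimono_on {..<n} y" and "k \<le> n"
  shows "(\<Sum>j<k. x j) \<le> (\<Sum>j<k. y j)"
proof (cases k)
  case (Suc l)
  define h where "h t = max 0 (t - y l)" for t :: real
  have "convex_on UNIV h" unfolding h_def by (rule convex_on_hinge)
  then have hinge: "(\<Sum>j<n. h (x j)) \<le> (\<Sum>j<n. h (y j))"
    using maj by (auto simp: majorized_def sum_unfold_sum_mset multiset.map_comp o_def)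
  have "(\<Sum>j<k. x j - y l) \<le> (\<Sum>j<k. h (x j))"
    by (intro sum_mono) (simp add: h_def)
  also have "\<dots> \<le> (\<Sum>j<n. h (x j))"
    using \<open>k \<le> n\<close> by (intro sum_mono2) (auto simp: h_def)
  also note hinge
  also have "(\<Sum>j<n. h (y j)) = (\<Sum>j<k. h (y j))"
    using \<open>k \<le> n\<close> y Suc by (intro sum.mono_neutral_right) (auto simp: h_def monotone_on_def)
  also have "\<dots> = (\<Sum>j<k. y j - y l)"
    using \<open>k \<le> n\<close> y Suc by (intro sum.cong) (auto simp: h_def monotone_on_def)
  finally show ?thesis by (simp add: sum_subtractf)
qed simp

lemma majorized_sum_eq:
  fixes x y :: "nat \<Rightarrow> real"
  assumes "image_mset x (mset_set {..<n}) \<prec> image_mset y (mset_set {..<n})"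
  shows "(\<Sum>j<n. x j) = (\<Sum>j<n. y j)"
proof -
  have "convex_on UNIV (\<lambda>t::real. t)" "convex_on UNIV (\<lambda>t::real. - t)"
    by (auto simp: convex_on_def)
  then have "(\<Sum>j<n. x j) \<le> (\<Sum>j<n. y j)" "(\<Sum>j<n. - x j) \<le> (\<Sum>j<n. - y j)"
    using assms unfolding majorized_def
    by (auto simp: sum_unfold_sum_mset multiset.map_comp o_def simp del: sum_mset.neutral)
  then show ?thesis by (simp add: sum_negf)
qed

lemma image_mset_permutes:
  assumes "p permutes {..<n}"
  shows "image_mset (f \<circ> p) (mset_set {..<n}) = image_mset f (mset_set {..<n})"
proof -
  have "image_mset p (mset_set {..<n}) = mset_set {..<n}"
    using assms by (simp add: image_mset_mset_set permutes_inj_on permutes_image)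
  then show ?thesis by (simp flip: multiset.map_comp)
qed

text \<open>
  Ordering \<open>y\<close> in the same way as the weights \<open>c\<close> is the best choice.  After sorting by \<open>c\<close>, the
  differences \<open>y j - x j\<close> have nonnegative partial sums and total zero, so summation by parts
  applies.  This one-sided form of majorization replaces the representation of \<open>x\<close> by a doubly
  stochastic matrix.
\<close>
lemma majorized_imp_weighted_sum_le:
  fixes x c :: "nat \<Rightarrow> real"
  assumes maj: "image_mset x (mset_set {..<n}) \<prec> Y"
  obtains y where "image_mset y (mset_set {..<n}) = Y"
    "(\<Sum>j<n. c j * x j) \<le> (\<Sum>j<n. c j * y j)"
proof -
  have "size Y = n" using maj by (simp add: majorized_def)
  then obtain y0 where y0: "image_mset y0 (mset_set {..<n}) = Y"
    by (rule mset_eq_image_mset_lessThan)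
  obtain q where q: "q permutes {..<n}" "antimono_on {..<n} (c \<circ> q)"
    by (rule antimono_rearrangement)
  obtain r where r: "r permutes {..<n}" "antimono_on {..<n} (y0 \<circ> r)"
    by (rule antimono_rearrangement)
  define x' where "x' = x \<circ> q"
  define y' where "y' = y0 \<circ> r"
  have maj': "image_mset x' (mset_set {..<n}) \<prec> image_mset y' (mset_set {..<n})"
    using maj by (simp only: x'_def y'_def image_mset_permutes[OF q(1)] image_mset_permutes[OF r(1)] y0)
  have "0 \<le> (\<Sum>j<n. (c \<circ> q) j * (y' j - x' j))"
    using majorized_partial_sums[OF maj'] majorized_sum_eq[OF maj'] r(2)
    by (intro abel_summation_nonneg q(2)) (auto simp: sum_subtractf y'_def)
  then have le: "(\<Sum>j<n. c (q j) * x' j) \<le> (\<Sum>j<n. c (q j) * y' j)"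
    by (simp add: algebra_simps sum_subtractf)
  define y where "y = y' \<circ> inv_into UNIV q"
  have "(\<Sum>j<n. c j * x j) = (\<Sum>j<n. c (q j) * x' j)"
    by (subst sum.permute[OF q(1)]) (simp add: x'_def o_def)
  also note le
  also have "(\<Sum>j<n. c (q j) * y' j) = (\<Sum>j<n. c j * y j)"
    by (subst (2) sum.permute[OF q(1)]) (simp add: y_def o_def permutes_inverses[OF q(1)])
  finally have "(\<Sum>j<n. c j * x j) \<le> (\<Sum>j<n. c j * y j)" .
  moreover have "image_mset y (mset_set {..<n}) = Y"
    by (simp only: y_def y'_def image_mset_permutes[OF permutes_inv[OF q(1)]]
        image_mset_permutes[OF r(1)] y0)
  ultimately show ?thesis using that by blast
qed

section \<open>Convex functions of the eigenvalues of a compression\<close>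

text \<open>
  The squared entries of an orthogonal matrix form a doubly stochastic matrix: the row sums allow
  Jensen's inequality, the column sums collect the result.
\<close>
lemma convex_sum_orthogonal_squares_le:
  assumes R: "orthogonal_mat m R" and f: "convex_on UNIV f"
  shows "(\<Sum>i<m. f (\<Sum>k<m. (R $$ (i, k))^2 * e k)) \<le> (\<Sum>k<m. f (e k))"
proof -
  have Rc: "R \<in> carrier_mat m m" "R * R\<^sup>T = 1\<^sub>m m" "R\<^sup>T * R = 1\<^sub>m m"
    using R by (auto simp: orthogonal_mat_def)
  have row: "(\<Sum>k<m. (R $$ (i, k))^2) = 1" if "i < m" for i
    using arg_cong[OF Rc(2), of "\<lambda>M. M $$ (i, i)"] Rc(1) that
    by (simp add: scalar_prod_def atLeast0LessThan power2_eq_square)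
  have col: "(\<Sum>i<m. (R $$ (i, k))^2) = 1" if "k < m" for k
    using arg_cong[OF Rc(3), of "\<lambda>M. M $$ (k, k)"] Rc(1) that
    by (simp add: scalar_prod_def atLeast0LessThan power2_eq_square)
  have "(\<Sum>i<m. f (\<Sum>k<m. (R $$ (i, k))^2 * e k)) \<le> (\<Sum>i<m. \<Sum>k<m. (R $$ (i, k))^2 * f (e k))"
  proof (intro sum_mono)
    fix i assume "i \<in> {..<m}"
    then show "f (\<Sum>k<m. (R $$ (i, k))^2 * e k) \<le> (\<Sum>k<m. (R $$ (i, k))^2 * f (e k))"
      using convex_on_sum[of "{..<m}" UNIV f "\<lambda>k. (R $$ (i, k))^2" e] f row by auto
  qed
  also have "\<dots> = (\<Sum>k<m. (\<Sum>i<m. (R $$ (i, k))^2) * f (e k))"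
    unfolding sum_distrib_right by (rule sum.swap)
  also have "\<dots> = (\<Sum>k<m. f (e k))"
    using col by (intro sum.cong) auto
  finally show ?thesis .
qed

lemma conjugate_diag_index:
  fixes K :: "real mat"
  assumes "K \<in> carrier_mat m n" "i < m"
  shows "(K * mat_diag n x * K\<^sup>T) $$ (i, i) = (\<Sum>j<n. (K $$ (i, j))^2 * x j)"
  using assms by (subst mat_diag_mult_right[OF assms(1)])
    (auto simp: scalar_prod_def atLeast0LessThan power2_eq_square mult_ac intro!: sum.cong)

lemma convex_on_real_subgradient:
  fixes f :: "real \<Rightarrow> real"
  assumes "convex_on UNIV f"
  obtains g where "\<And>a b. f a + g a * (b - a) \<le> f b"
proof
  fix a b
  show "f a + Inf ((\<lambda>t. (f a - f t) / (a - t)) ` ({a<..} \<inter> UNIV)) * (b - a) \<le> f b"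
    by (rule convex_le_Inf_differential[OF assms]) simp_all
qed

text \<open>
  The eigenvalues of the compression of \<open>diag(x)\<close> are compared with the eigenvalues \<open>E\<close> of the
  compression of \<open>diag(y)\<close>, for \<open>y\<close> an enumeration of \<open>Y\<close>.  That \<open>E\<close> is the same for every
  enumeration is essential: the proof chooses \<open>y\<close> according to the subgradients of \<open>f\<close> at the
  eigenvalues of the first compression.
\<close>
lemma convex_trace_compression_le:
  fixes x :: "nat \<Rightarrow> real"
  assumes G: "G \<in> carrier_mat m n"
    and maj: "image_mset x (mset_set {..<n}) \<prec> Y"
    and U: "orthogonal_mat m U" "G * mat_diag n x * G\<^sup>T = U * mat_diag m d * U\<^sup>T"
    and V: "\<And>y. image_mset y (mset_set {..<n}) = Y \<Longrightarrow>
      \<exists>V e. orthogonal_mat m V \<and> G * mat_diag n y * G\<^sup>T = V * mat_diag m e * V\<^sup>T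
        \<and> image_mset e (mset_set {..<m}) = E"
    and f: "convex_on UNIV f"
  shows "(\<Sum>i<m. f (d i)) \<le> (\<Sum>t\<in>#E. f t)"
proof -
  have Uc: "U \<in> carrier_mat m m" "U\<^sup>T * U = 1\<^sub>m m" using U by (auto simp: orthogonal_mat_def)
  have UT: "U\<^sup>T \<in> carrier_mat m m" using Uc(1) by simp
  obtain g where g: "\<And>a b. f a + g a * (b - a) \<le> f b"
    using convex_on_real_subgradient[OF f] by blast
  \<comment> \<open>The rows of \<open>K\<close> are the eigenvectors of the compression of \<open>diag(x)\<close>, in the coordinates of
    the large space; the diagonal entries in this basis are linear in the tuple.\<close>
  define K where "K = U\<^sup>T * G"
  have Kc: "K \<in> carrier_mat m n" using Uc G by (simp add: K_def)
  have K: "K * mat_diag n y * K\<^sup>T = U\<^sup>T * (G * mat_diag n y * G\<^sup>T) * U" for y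
    by (simp only: K_def conjugate_mult[OF G UT mat_diag_dim] transpose_transpose)
  have d: "d i = (\<Sum>j<n. (K $$ (i, j))^2 * x j)" if "i < m" for i
  proof -
    have "K * mat_diag n x * K\<^sup>T = (U\<^sup>T * U) * mat_diag m d * (U\<^sup>T * U)\<^sup>T"
      by (simp only: K U(2) conjugate_mult[OF Uc(1) UT mat_diag_dim] transpose_transpose)
    also have "\<dots> = mat_diag m d"
      by (simp add: Uc(2) left_mult_one_mat[OF mat_diag_dim] right_mult_one_mat[OF mat_diag_dim])
    finally have "K * mat_diag n x * K\<^sup>T = mat_diag m d" .
    then show ?thesis
      using conjugate_diag_index[OF Kc that, of x] that by (simp add: mat_diag_def)
  qed
  \<comment> \<open>The weight that \<open>y j\<close> receives when the diagonal entries are weighted by the subgradients.\<close>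
  define c where "c j = (\<Sum>i<m. g (d i) * (K $$ (i, j))^2)" for j
  obtain y where y: "image_mset y (mset_set {..<n}) = Y"
    and cy: "(\<Sum>j<n. c j * x j) \<le> (\<Sum>j<n. c j * y j)"
    using majorized_imp_weighted_sum_le[OF maj] by blast
  obtain V e where V: "orthogonal_mat m V" "G * mat_diag n y * G\<^sup>T = V * mat_diag m e * V\<^sup>T"
    and E: "image_mset e (mset_set {..<m}) = E"
    using V[OF y] by blast
  have Vc: "V \<in> carrier_mat m m" using V by (simp add: orthogonal_mat_def)
  define w where "w i = (\<Sum>j<n. (K $$ (i, j))^2 * y j)" for i
  \<comment> \<open>The change of basis between the eigenvectors of the two compressions.\<close>
  define R where "R = U\<^sup>T * V"
  have "orthogonal_mat m (U\<^sup>T)" using U(1) by (simp add: orthogonal_mat_def)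
  then have R: "orthogonal_mat m R" unfolding R_def using V(1) by (rule orthogonal_mat_mult)
  have Rc: "R \<in> carrier_mat m m" using R by (simp add: orthogonal_mat_def)
  have "K * mat_diag n y * K\<^sup>T = R * mat_diag m e * R\<^sup>T"
    by (simp only: K V(2) R_def conjugate_mult[OF Vc UT mat_diag_dim] transpose_transpose)
  then have w: "w i = (\<Sum>k<m. (R $$ (i, k))^2 * e k)" if "i < m" for i
    using conjugate_diag_index[OF Kc that, of y] conjugate_diag_index[OF Rc that, of e]
    by (simp add: w_def)
  have weights: "(\<Sum>i<m. g (d i) * (\<Sum>j<n. (K $$ (i, j))^2 * z j)) = (\<Sum>j<n. c j * z j)" for z
    unfolding c_def sum_distrib_left sum_distrib_right
    by (subst sum.swap) (simp add: mult.assoc)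
  have "(\<Sum>i<m. g (d i) * (w i - d i)) = (\<Sum>i<m. g (d i) * w i) - (\<Sum>i<m. g (d i) * d i)"
    by (simp add: algebra_simps sum_subtractf)
  also have "(\<Sum>i<m. g (d i) * w i) = (\<Sum>j<n. c j * y j)"
    by (simp add: w_def weights)
  also have "(\<Sum>i<m. g (d i) * d i) = (\<Sum>i<m. g (d i) * (\<Sum>j<n. (K $$ (i, j))^2 * x j))"
    using d by (intro sum.cong refl arg_cong2[where f = "(*)"]) auto
  also have "\<dots> = (\<Sum>j<n. c j * x j)" by (rule weights)
  finally have "0 \<le> (\<Sum>i<m. g (d i) * (w i - d i))" using cy by simp
  then have "(\<Sum>i<m. f (d i)) \<le> (\<Sum>i<m. f (d i) + g (d i) * (w i - d i))"
    by (simp add: sum.distrib)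
  also have "\<dots> \<le> (\<Sum>i<m. f (w i))" by (intro sum_mono g)
  also have "\<dots> = (\<Sum>i<m. f (\<Sum>k<m. (R $$ (i, k))^2 * e k))" using w by simp
  also have "\<dots> \<le> (\<Sum>k<m. f (e k))" by (rule convex_sum_orthogonal_squares_le[OF R f])
  also have "\<dots> = (\<Sum>t\<in>#E. f t)"
    by (simp add: E[symmetric] sum_unfold_sum_mset multiset.map_comp o_def)
  finally show ?thesis .
qed

section \<open>Differentiation preserves the spectral order\<close>

theorem corollary1:
  fixes n :: nat and P Q :: "real poly"
  assumes "n \<ge> 1"
    and "P \<in> hyperbolic_polys n" and "Q \<in> hyperbolic_polys n"
    and "P \<preceq> Q"
  shows "smult (inverse (real n)) (pderiv P) \<in> hyperbolic_polys (n - 1)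
    \<and> smult (inverse (real n)) (pderiv Q) \<in> hyperbolic_polys (n - 1)
    \<and> smult (inverse (real n)) (pderiv P) \<preceq> smult (inverse (real n)) (pderiv Q)"
proof -
  obtain m where n: "n = Suc m" using \<open>n \<ge> 1\<close> by (cases n) auto
  let ?D = "\<lambda>P. smult (inverse (real n)) (pderiv P)"
  obtain G :: "real mat" where G: "G \<in> carrier_mat m n"
    and cp: "\<And>x. char_poly (G * mat_diag n x * G\<^sup>T)
      = smult (1 / real n) (pderiv (\<Prod>j<n. [:- x j, 1:]))"
    using derivative_is_compression[of m] unfolding n by blast
  have compression: "\<exists>U d. orthogonal_mat m U \<and> G * mat_diag n x * G\<^sup>T = U * mat_diag m d * U\<^sup>T
      \<and> ?D S = (\<Prod>k<m. [:- d k, 1:])"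
    if S: "S \<in> hyperbolic_polys n" "image_mset x (mset_set {..<n}) = proots S" for S x
  proof -
    let ?C = "G * mat_diag n x * G\<^sup>T"
    have "?C \<in> carrier_mat m m"
      using G by (auto intro!: mult_carrier_mat[of _ m n])
    moreover have "?C\<^sup>T = ?C"
      unfolding mat_diag_mult_right[OF G] using G
      by (intro eq_matI) (auto simp: scalar_prod_def mult_ac)
    ultimately obtain U d where U: "orthogonal_mat m U" "?C = U * mat_diag m d * U\<^sup>T"
      by (rule symmetric_mat_diagonalization)
    have "?D S = char_poly ?C"
      by (simp add: cp hyperbolic_poly_eq_prod[OF S, symmetric] inverse_eq_divide)
    also have "\<dots> = (\<Prod>k<m. [:- d k, 1:])" by (rule char_poly_orthogonal_diagonal[OF U])
    finally show ?thesis using U by blast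
  qed
  obtain x where x: "image_mset x (mset_set {..<n}) = proots P"
    using size_proots_hyperbolic[OF assms(2)] by (rule mset_eq_image_mset_lessThan)
  obtain y where y: "image_mset y (mset_set {..<n}) = proots Q"
    using size_proots_hyperbolic[OF assms(3)] by (rule mset_eq_image_mset_lessThan)
  obtain U d where U: "orthogonal_mat m U" "G * mat_diag n x * G\<^sup>T = U * mat_diag m d * U\<^sup>T"
    and d: "?D P = (\<Prod>k<m. [:- d k, 1:])"
    using compression[OF assms(2) x] by blast
  obtain e where e: "?D Q = (\<Prod>k<m. [:- e k, 1:])"
    using compression[OF assms(3) y] by blast
  have V: "\<exists>V e. orthogonal_mat m V \<and> G * mat_diag n y * G\<^sup>T = V * mat_diag m e * V\<^sup>T
      \<and> image_mset e (mset_set {..<m}) = proots (?D Q)"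
    if y: "image_mset y (mset_set {..<n}) = proots Q" for y
  proof -
    obtain V e where "orthogonal_mat m V" "G * mat_diag n y * G\<^sup>T = V * mat_diag m e * V\<^sup>T"
      and e: "?D Q = (\<Prod>k<m. [:- e k, 1:])"
      using compression[OF assms(3) y] by blast
    moreover have "image_mset e (mset_set {..<m}) = proots (?D Q)"
      unfolding e by (rule prod_linear_hyperbolic(2)[symmetric])
    ultimately show ?thesis by blast
  qed
  have "image_mset d (mset_set {..<m}) \<prec> proots (?D Q)"
    unfolding majorized_def
  proof (intro conjI allI impI)
    show "size (image_mset d (mset_set {..<m})) = size (proots (?D Q))"
      by (simp add: e prod_linear_hyperbolic)
    fix f :: "real \<Rightarrow> real" assume f: "convex_on UNIV f"
    have maj: "image_mset x (mset_set {..<n}) \<prec> proots Q"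
      using assms(4) by (simp add: spectral_le_def x)
    have "(\<Sum>i<m. f (d i)) \<le> (\<Sum>t\<in>#proots (?D Q). f t)"
      by (rule convex_trace_compression_le[OF G maj U V f])
    then show "(\<Sum>x\<in>#image_mset d (mset_set {..<m}). f x) \<le> (\<Sum>y\<in>#proots (?D Q). f y)"
      by (simp add: sum_unfold_sum_mset multiset.map_comp o_def)
  qed
  then have "?D P \<preceq> ?D Q" by (simp only: spectral_le_def d prod_linear_hyperbolic)
  moreover have "?D P \<in> hyperbolic_polys (n - 1)" "?D Q \<in> hyperbolic_polys (n - 1)"
    unfolding d e by (simp_all add: n prod_linear_hyperbolic)
  ultimately show ?thesis by blast
qed

end
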